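(* Let $H \le G$ be finite groups such that the interval $[H,G]$ is a distributive lattice. Then there exists an irreducible complex representation $V$ of $G$ such that $G_{(V^H)} = H$.
   Context: For subgroups $H \le G$, the interval $[H,G]$ is the set of subgroups $K$ with $H \le K \le G$, ordered by inclusion; it is a lattice with meet $K_1 \wedge K_2 = K_1 \cap K_2$ and join $K_1 \vee K_2 = \langle K_1, K_2\rangle$. For a representation $W$ of a group $G$, a subgroup $K \le G$ and a subspace $X \subseteq W$: the fixed-point subspace is $W^K = \{w \in W : kw = w \ \forall k \in K\}$, and the pointwise stabilizer is $G_{(X)} = \{g \in G : gx = x \ \forall x \in X\}$. *)

theory Defs
  imports "HOL-Algebra.Group" "HOL-Algebra.Generated_Groups" "Jordan_Normal_Form.Matrix"
begin

definition subgroup_interval :: "('g, 'b) monoid_scheme \<Rightarrow> 'g set \<Rightarrow> 'g set set" where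
  "subgroup_interval G H = {K. subgroup K G \<and> H \<subseteq> K}"

(* [H,G] is distributive: meet = intersection, join = generated subgroup *)
definition interval_distributive :: "('g, 'b) monoid_scheme \<Rightarrow> 'g set \<Rightarrow> bool" where
  "interval_distributive G H \<longleftrightarrow>
     (\<forall>K1\<in>subgroup_interval G H. \<forall>K2\<in>subgroup_interval G H. \<forall>K3\<in>subgroup_interval G H.
        K1 \<inter> generate G (K2 \<union> K3) = generate G ((K1 \<inter> K2) \<union> (K1 \<inter> K3)))"

definition is_rep :: "('g, 'b) monoid_scheme \<Rightarrow> nat \<Rightarrow> ('g \<Rightarrow> complex mat) \<Rightarrow> bool" where
  "is_rep G n \<rho> \<longleftrightarrow>
     (\<forall>g\<in>carrier G. \<rho> g \<in> carrier_mat n n) \<and>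
     (\<forall>g\<in>carrier G. \<forall>h\<in>carrier G. \<rho> (g \<otimes>\<^bsub>G\<^esub> h) = \<rho> g * \<rho> h) \<and>
     \<rho> \<one>\<^bsub>G\<^esub> = 1\<^sub>m n"

definition is_subspace :: "nat \<Rightarrow> complex vec set \<Rightarrow> bool" where
  "is_subspace n W \<longleftrightarrow> W \<subseteq> carrier_vec n \<and> 0\<^sub>v n \<in> W \<and>
     (\<forall>v\<in>W. \<forall>w\<in>W. v + w \<in> W) \<and> (\<forall>c. \<forall>v\<in>W. c \<cdot>\<^sub>v v \<in> W)"

definition is_irred_rep :: "('g, 'b) monoid_scheme \<Rightarrow> nat \<Rightarrow> ('g \<Rightarrow> complex mat) \<Rightarrow> bool" where
  "is_irred_rep G n \<rho> \<longleftrightarrow> is_rep G n \<rho> \<and> n > 0 \<and>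
     (\<forall>W. is_subspace n W \<and> (\<forall>g\<in>carrier G. \<forall>w\<in>W. \<rho> g *\<^sub>v w \<in> W) \<longrightarrow>
          W = {0\<^sub>v n} \<or> W = carrier_vec n)"

definition fixed_space :: "nat \<Rightarrow> ('g \<Rightarrow> complex mat) \<Rightarrow> 'g set \<Rightarrow> complex vec set" where
  "fixed_space n \<rho> K = {w \<in> carrier_vec n. \<forall>k\<in>K. \<rho> k *\<^sub>v w = w}"

definition pointwise_stab :: "('g, 'b) monoid_scheme \<Rightarrow> ('g \<Rightarrow> complex mat) \<Rightarrow> complex vec set \<Rightarrow> 'g set" where
  "pointwise_stab G \<rho> X = {g \<in> carrier G. \<forall>x\<in>X. \<rho> g *\<^sub>v x = x}"

end

theory Submission
  imports Defs "Jordan_Normal_Form.DL_Rank"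
begin

text \<open>
  Let \<open>K\<^sub>1, \<dots>, K\<^sub>r\<close> be the atoms of \<open>[H,G]\<close>, let \<open>M\<^sub>i\<close> be the join of the atoms other than
  \<open>K\<^sub>i\<close>, and let \<open>e\<^sub>K\<close> be the averaging idempotent of \<open>K\<close> in the complex group algebra.
  By distributivity \<open>K\<^sub>i \<inter> M\<^sub>i = H\<close>, so a product \<open>g = k\<^sub>1 \<cdots> k\<^sub>r\<close> with \<open>k\<^sub>i \<in> K\<^sub>i - H\<close> lies in
  no \<open>M\<^sub>i\<close>. In the expansion of \<open>x = (e\<^sub>H - e\<^sub>K\<^sub>1) \<cdots> (e\<^sub>H - e\<^sub>K\<^sub>r)\<close> every term except the one with
  all \<open>e\<^sub>K\<^sub>i\<close> is supported in some \<open>M\<^sub>i\<close>, so the coefficient of \<open>x\<close> at \<open>g\<close> is nonzero.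
  Hence \<open>x\<close> acts nontrivially on some irreducible \<open>V\<close>, and therefore so does each factor, that is,
  \<open>V\<close> has an \<open>H\<close>-fixed vector not fixed by \<open>K\<^sub>i\<close>. The pointwise stabilizer of the \<open>H\<close>-fixed
  vectors thus contains no atom and equals \<open>H\<close>.

  Complete reducibility is not needed to find \<open>V\<close>: after translating \<open>x\<close> so that its coefficient
  at the identity is nonzero, its trace in the regular representation is nonzero, and traces are
  additive along composition series.
\<close>

subsection \<open>Irreducible constituents via traces\<close>

text \<open>Independent sets have at most \<open>n\<close> elements, so one of maximal cardinality
  exists between \<open>A\<close> and \<open>X\<close>; a vector of \<open>X\<close> outside its
  span could be adjoined. This serves both to find a basis of a subspace and to extend it to the
  whole space.\<close>

lemma (in vec_space) lin_indpt_extends_to_spanning: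
  assumes A: "A \<subseteq> X" "lin_indpt A" and X: "X \<subseteq> carrier_vec n"
  obtains B where "A \<subseteq> B" "B \<subseteq> X" "finite B" "lin_indpt B" "X \<subseteq> span B"
proof -
  let ?P = "\<lambda>B. A \<subseteq> B \<and> B \<subseteq> X \<and> lin_indpt B"
  have bound: "finite B \<and> card B \<le> n" if "?P B" for B
    using that X li_le_dim[of B] dim_is_n by auto
  obtain B where B: "?P B" and max: "\<And>C. ?P C \<Longrightarrow> card C \<le> card B"
    using ex_has_greatest_nat[of ?P A card "Suc n"] A bound by (auto simp: less_Suc_eq_le)
  have "v \<in> span B" if v: "v \<in> X" for v
  proof (cases "v \<in> B")
    case True
    then show ?thesis using in_own_span[of B] B X by auto
  next
    case False
    have "\<not> lin_indpt (B \<union> {v})"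
    proof
      assume "lin_indpt (B \<union> {v})"
      then have "card (B \<union> {v}) \<le> card B" using B v by (intro max) auto
      then show False using False bound[OF B] by simp
    qed
    then show ?thesis
      using lin_dep_iff_in_span[of B v] False B v X by auto
  qed
  then show thesis using that B bound[OF B] by blast
qed

lemma is_subspace_imp_submodule:
  assumes "is_subspace n W"
  shows "submodule class_ring W (module_vec TYPE(complex) n)"
proof -
  interpret vec_space "TYPE(complex)" n .
  show ?thesis
    using assms unfolding is_subspace_def
    by unfold_locales (auto simp: module_vec_simps)
qed

text \<open>The columns of \<open>P\<close> are a basis of \<open>W\<close> followed by a completion
  to a basis of the whole space, so \<open>Q\<close> reads off coordinates and vectors of
  \<open>W\<close> have none beyond the first \<open>m\<close>. That \<open>W\<close> is nonzero and
  proper gives \<open>0 < m < n\<close>, which later makes both diagonal blocks smaller.\<close>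

lemma adapted_basis_matrix:
  assumes W: "is_subspace n W" and "W \<noteq> {0\<^sub>v n}" "W \<noteq> carrier_vec n"
  obtains m P Q where "0 < m" "m < n" "P \<in> carrier_mat n n" "Q \<in> carrier_mat n n"
    "Q * P = 1\<^sub>m n" "P * Q = 1\<^sub>m n" "\<And>j. j < m \<Longrightarrow> col P j \<in> W"
    "\<And>w i. w \<in> W \<Longrightarrow> m \<le> i \<Longrightarrow> i < n \<Longrightarrow> (Q *\<^sub>v w) $ i = 0"
proof -
  interpret vec_space "TYPE(complex)" n .
  have Wc: "W \<subseteq> carrier_vec n" and W0: "0\<^sub>v n \<in> W" using W by (auto simp: is_subspace_def)
  have "lin_indpt {}" by (auto simp: lin_dep_def)
  then obtain A where A: "A \<subseteq> W" "finite A" "lin_indpt A" "W \<subseteq> span A"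
    using lin_indpt_extends_to_spanning[of "{}" W, OF _ _ Wc] by (metis empty_subsetI)
  obtain B where B: "A \<subseteq> B" "B \<subseteq> carrier_vec n" "finite B" "lin_indpt B" "carrier_vec n \<subseteq> span B"
    using lin_indpt_extends_to_spanning[of A "carrier_vec n"] A(1,3) Wc by (metis subset_refl subset_trans)
  have spanA: "span A \<subseteq> W"
    using span_is_subset[OF A(1)] is_subspace_imp_submodule[OF W] by auto
  have basis: "basis B"
    using B span_is_subset2[of B] by (auto simp: basis_def)
  then have cardB: "card B = n" using dim_basis[of B] B dim_is_n by auto
  obtain as where as: "set as = A" "distinct as" using A(2) finite_distinct_list by blast
  obtain bs where bs: "set bs = B - A" "distinct bs" using B(3) finite_distinct_list[of "B - A"] by blast
  define vs where "vs = as @ bs"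
  define m where "m = length as"
  have vs: "set vs = B" "distinct vs" "length vs = n"
  proof -
    show s: "set vs = B" and d: "distinct vs" using as bs B(1) by (auto simp: vs_def)
    show "length vs = n" using distinct_card[OF d] s cardB by simp
  qed
  have mA: "m = card A" using distinct_card[OF as(2)] as(1) by (simp add: m_def)
  have "A \<noteq> {}"
  proof
    assume "A = {}"
    then have "W \<subseteq> {0\<^sub>v n}" using A(4) span_empty by (simp add: module_vec_simps)
    then show False using assms(2) W0 by auto
  qed
  then have m0: "0 < m" using mA A(2) by (simp add: card_gt_0_iff)
  have "A \<noteq> B"
    using spanA B(5) Wc assms(3) by auto
  then have mn: "m < n" using mA cardB B by (metis psubsetI psubset_card_mono)
  define P where "P = mat_of_cols n vs"
  have P: "P \<in> carrier_mat n n" using vs(3) mat_of_cols_carrier(1)[of n vs] by (simp add: P_def)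
  have cols: "cols P = vs" using vs(1) B(2) by (simp add: P_def)
  have "rank P = n" using lin_indpt_full_rank[OF P] cols vs B by simp
  then have "det P \<noteq> 0" using det_rank_iff[OF P] by simp
  \<comment> \<open>The value \<open>()\<close> merely fills the extension slot of the matrix ring
    record; a unit of that ring has a two-sided inverse.\<close>
  from det_non_zero_imp_unit[OF P this, of "()"]
  obtain Q where Q: "Q \<in> carrier_mat n n" "Q * P = 1\<^sub>m n" "P * Q = 1\<^sub>m n"
    by (auto simp: Units_def ring_mat_def)
  have colP: "col P j = as ! j" if "j < m" for j
    using that mn vs B(2) by (simp add: P_def vs_def m_def nth_append col_mat_of_cols)
      (metis Un_iff B(1) as(1) col_mat_of_cols length_append nth_append nth_mem set_append subsetD trans_less_add1 vs_def vs(1))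
  have colW: "col P j \<in> W" if "j < m" for j
    using colP[OF that] that as A(1) by (auto simp: m_def)
  \<comment> \<open>The vectors whose coordinates from \<open>m\<close> on vanish. This subspace
    contains \<open>A\<close>, hence the span of \<open>A\<close>, hence \<open>W\<close>.\<close>
  let ?S = "{w \<in> carrier_vec n. \<forall>i. m \<le> i \<longrightarrow> i < n \<longrightarrow> (Q *\<^sub>v w) $ i = 0}"
  have S: "is_subspace n ?S"
    unfolding is_subspace_def using Q
    by (auto simp: scalar_prod_add_distrib[of _ n])
  have "A \<subseteq> ?S"
  proof
    fix a assume a: "a \<in> A"
    then obtain j where j: "j < m" "a = as ! j" using as by (auto simp: m_def in_set_conv_nth)
    have "Q *\<^sub>v a = col (Q * P) j"
      using j colP[OF j(1)] mn col_mult2[OF Q(1) P, of j] by simp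
    then have "Q *\<^sub>v a = unit_vec n j" using Q(2) j mn by simp
    then show "a \<in> ?S"
      using a j(1) mn A(1) Wc by (auto simp del: index_mult_mat_vec)
  qed
  then have "span A \<subseteq> ?S" by (rule span_is_subset[OF _ is_subspace_imp_submodule[OF S]])
  then have WS: "W \<subseteq> ?S" using A(4) by (rule subset_trans[rotated])
  show thesis
    by (rule that[OF m0 mn P Q(1,2,3) colW]) (use WS in \<open>auto simp del: index_mult_mat_vec\<close>)
qed

section \<open>Traces under change of basis and block decomposition\<close>

definition mat_trace :: "nat \<Rightarrow> complex mat \<Rightarrow> complex" where
  "mat_trace n M = (\<Sum>i<n. M $$ (i, i))"

lemma mat_mult_index_sum:
  assumes "A \<in> carrier_mat n m" "B \<in> carrier_mat m k" "i < n" "j < k"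
  shows "(A * B) $$ (i, j) = (\<Sum>l<m. A $$ (i, l) * B $$ (l, j))"
  using assms by (auto simp: scalar_prod_def lessThan_atLeast0 intro!: sum.cong)

lemma mat_trace_mult_comm:
  assumes "A \<in> carrier_mat n n" "B \<in> carrier_mat n n"
  shows "mat_trace n (A * B) = mat_trace n (B * A)"
proof -
  have "mat_trace n (A * B) = (\<Sum>i<n. \<Sum>l<n. A $$ (i, l) * B $$ (l, i))"
    unfolding mat_trace_def using mat_mult_index_sum[OF assms] by simp
  also have "\<dots> = (\<Sum>l<n. \<Sum>i<n. B $$ (l, i) * A $$ (i, l))"
    by (subst sum.swap) (simp add: mult.commute)
  also have "\<dots> = mat_trace n (B * A)"
    unfolding mat_trace_def using mat_mult_index_sum[OF assms(2,1)] by simp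
  finally show ?thesis .
qed

lemma is_rep_similar:
  assumes rep: "is_rep G n \<rho>" and P: "P \<in> carrier_mat n n" and Q: "Q \<in> carrier_mat n n"
    and inv: "Q * P = 1\<^sub>m n" "P * Q = 1\<^sub>m n"
  shows "is_rep G n (\<lambda>g. Q * \<rho> g * P)"
proof -
  have "Q * (\<rho> g * \<rho> h) * P = Q * \<rho> g * P * (Q * \<rho> h * P)"
    if "g \<in> carrier G" "h \<in> carrier G" for g h
  proof -
    have c: "\<rho> g \<in> carrier_mat n n" "\<rho> h \<in> carrier_mat n n" using rep that by (auto simp: is_rep_def)
    have "Q * \<rho> g * P * (Q * \<rho> h * P) = Q * \<rho> g * (P * Q) * \<rho> h * P"
      using c P Q by (simp add: assoc_mult_mat[of _ n n _ n _ n])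
    also have "\<dots> = Q * (\<rho> g * \<rho> h) * P"
      using c P Q inv by (simp add: assoc_mult_mat[of _ n n _ n _ n])
    finally show ?thesis ..
  qed
  then show ?thesis
    using rep P Q inv by (auto simp: is_rep_def)
qed

lemma mat_trace_similar:
  assumes "M \<in> carrier_mat n n" and P: "P \<in> carrier_mat n n" and Q: "Q \<in> carrier_mat n n"
    and "P * Q = 1\<^sub>m n"
  shows "mat_trace n (Q * M * P) = mat_trace n M"
proof -
  have "mat_trace n (Q * M * P) = mat_trace n (P * (Q * M))"
    using assms by (intro mat_trace_mult_comm) auto
  also have "P * (Q * M) = P * Q * M" using assms by (intro assoc_mult_mat[symmetric])
  finally show ?thesis using assms by simp
qed

lemma sum_lessThan_shift:
  fixes f :: "nat \<Rightarrow> 'a :: comm_monoid_add"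
  assumes "m \<le> n"
  shows "(\<Sum>i<n. f i) = (\<Sum>i<m. f i) + (\<Sum>i<n-m. f (m + i))"
proof -
  have "(\<Sum>i<n. f i) = (\<Sum>i\<in>{0..<m} \<union> {m..<n}. f i)"
    using assms by (simp add: ivl_disj_un lessThan_atLeast0)
  also have "\<dots> = (\<Sum>i<m. f i) + (\<Sum>i\<in>{m..<n}. f i)"
    by (subst sum.union_disjoint) (auto simp: lessThan_atLeast0)
  also have "(\<Sum>i\<in>{m..<n}. f i) = (\<Sum>i<n-m. f (m + i))"
    using assms by (intro sum.reindex_bij_witness[of _ "\<lambda>i. m + i" "\<lambda>i. i - m"]) auto
  finally show ?thesis .
qed

text \<open>The blocks are the actions on an invariant subspace and on its quotient. When the inner
  sum of a matrix product is split at \<open>m\<close>, the vanishing lower left block removes the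
  half that mixes the two.\<close>

lemma block_triangular_diagonal_blocks_rep:
  assumes rep: "is_rep G n \<rho>" and "m \<le> n"
    and G: "\<And>g h. g \<in> carrier G \<Longrightarrow> h \<in> carrier G \<Longrightarrow> g \<otimes>\<^bsub>G\<^esub> h \<in> carrier G"
    and zero: "\<And>g i j. g \<in> carrier G \<Longrightarrow> m \<le> i \<Longrightarrow> i < n \<Longrightarrow> j < m \<Longrightarrow> \<rho> g $$ (i, j) = 0"
  shows "is_rep G m (\<lambda>g. mat m m (\<lambda>(i, j). \<rho> g $$ (i, j)))"
    and "is_rep G (n - m) (\<lambda>g. mat (n - m) (n - m) (\<lambda>(i, j). \<rho> g $$ (m + i, m + j)))"
proof -
  have prod: "\<rho> (g \<otimes>\<^bsub>G\<^esub> h) $$ (i, j) =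
      (\<Sum>l<m. \<rho> g $$ (i, l) * \<rho> h $$ (l, j)) + (\<Sum>l<n-m. \<rho> g $$ (i, m + l) * \<rho> h $$ (m + l, j))"
    if "g \<in> carrier G" "h \<in> carrier G" "i < n" "j < n" for g h i j
    using rep that mat_mult_index_sum[of "\<rho> g" n n "\<rho> h" n i j] sum_lessThan_shift[OF \<open>m \<le> n\<close>]
    by (simp add: is_rep_def)
  have one: "\<rho> \<one>\<^bsub>G\<^esub> = 1\<^sub>m n" using rep by (simp add: is_rep_def)
  let ?A = "\<lambda>g. mat m m (\<lambda>(i, j). \<rho> g $$ (i, j))"
  let ?D = "\<lambda>g. mat (n - m) (n - m) (\<lambda>(i, j). \<rho> g $$ (m + i, m + j))"
  have "?A (g \<otimes>\<^bsub>G\<^esub> h) = ?A g * ?A h" if "g \<in> carrier G" "h \<in> carrier G" for g h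
    using that \<open>m \<le> n\<close> zero
    by (intro eq_matI) (auto simp: prod mat_mult_index_sum[of _ m m _ m] simp del: index_mult_mat(1))
  then show "is_rep G m ?A" using \<open>m \<le> n\<close> one by (auto simp: is_rep_def)
  have "?D (g \<otimes>\<^bsub>G\<^esub> h) = ?D g * ?D h" if "g \<in> carrier G" "h \<in> carrier G" for g h
    using that \<open>m \<le> n\<close> zero
    by (intro eq_matI) (auto simp: prod mat_mult_index_sum[of _ "n-m" "n-m" _ "n-m"] simp del: index_mult_mat(1))
  then show "is_rep G (n - m) ?D" using \<open>m \<le> n\<close> one by (auto simp: is_rep_def)
qed

text \<open>Induction on the dimension: in the reducible case the trace is the sum of the traces on
  an invariant subspace and on the quotient, so a nonzero weighted sum survives in one of these
  smaller representations.\<close>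

lemma exists_irred_rep_trace_sum_nonzero:
  assumes "monoid G" and "is_rep G n \<rho>"
    and "(\<Sum>g\<in>carrier G. y g * mat_trace n (\<rho> g)) \<noteq> 0"
  shows "\<exists>m \<sigma>. is_irred_rep G m \<sigma> \<and> (\<Sum>g\<in>carrier G. y g * mat_trace m (\<sigma> g)) \<noteq> 0"
  using assms(2,3)
proof (induction n arbitrary: \<rho> rule: less_induct)
  case (less n)
  interpret monoid G by fact
  let ?tr = "\<lambda>m \<sigma>. (\<Sum>g\<in>carrier G. y g * mat_trace m (\<sigma> g))"
  show ?case
  proof (cases "is_irred_rep G n \<rho>")
    case True
    then show ?thesis using less.prems by blast
  next
    case False
    \<comment> \<open>In dimension 0 every trace is an empty sum. Hence irreducibility can fail only
      through a proper nonzero invariant subspace.\<close>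
    have "n > 0" using less.prems(2) by (cases n) (auto simp: mat_trace_def)
    then obtain W where W: "is_subspace n W" "W \<noteq> {0\<^sub>v n}" "W \<noteq> carrier_vec n"
      and inv: "\<And>g w. g \<in> carrier G \<Longrightarrow> w \<in> W \<Longrightarrow> \<rho> g *\<^sub>v w \<in> W"
      using False less.prems(1) unfolding is_irred_rep_def by blast
    obtain m P Q where m: "0 < m" "m < n" and P: "P \<in> carrier_mat n n" and Q: "Q \<in> carrier_mat n n"
      and PQ: "Q * P = 1\<^sub>m n" "P * Q = 1\<^sub>m n"
      and colW: "\<And>j. j < m \<Longrightarrow> col P j \<in> W"
      and QW: "\<And>w i. w \<in> W \<Longrightarrow> m \<le> i \<Longrightarrow> i < n \<Longrightarrow> (Q *\<^sub>v w) $ i = 0"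
      using adapted_basis_matrix[OF W] by metis
    define \<tau> where "\<tau> g = Q * \<rho> g * P" for g
    have car: "\<rho> g \<in> carrier_mat n n" if "g \<in> carrier G" for g
      using less.prems(1) that by (simp add: is_rep_def)
    have rep: "is_rep G n \<tau>" unfolding \<tau>_def by (rule is_rep_similar[OF less.prems(1) P Q PQ])
    \<comment> \<open>Column \<open>j\<close> consists of the \<open>Q\<close>-coordinates of the
      image of a basis vector of \<open>W\<close>, and this image stays in \<open>W\<close>.\<close>
    have zero: "\<tau> g $$ (i, j) = 0" if "g \<in> carrier G" "m \<le> i" "i < n" "j < m" for g i j
    proof -
      have "\<tau> g $$ (i, j) = col (Q * (\<rho> g * P)) j $ i"
        using that m P Q car by (simp add: \<tau>_def assoc_mult_mat[of _ n n _ n _ n])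
      also have "col (Q * (\<rho> g * P)) j = Q *\<^sub>v (\<rho> g *\<^sub>v col P j)"
        using that m P Q car[OF that(1)] by (simp add: col_mult2[of _ n n _ n])
      also have "\<dots> $ i = 0" using that by (intro QW inv colW)
      finally show ?thesis .
    qed
    let ?A = "\<lambda>g. mat m m (\<lambda>(i, j). \<tau> g $$ (i, j))"
    let ?D = "\<lambda>g. mat (n - m) (n - m) (\<lambda>(i, j). \<tau> g $$ (m + i, m + j))"
    have reps: "is_rep G m ?A" "is_rep G (n - m) ?D"
      using block_triangular_diagonal_blocks_rep[OF rep _ _ zero] m by auto
    have "mat_trace n (\<rho> g) = mat_trace m (?A g) + mat_trace (n - m) (?D g)"
      if "g \<in> carrier G" for g
    proof -
      have "mat_trace n (\<rho> g) = mat_trace n (\<tau> g)"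
        unfolding \<tau>_def using mat_trace_similar[OF car[OF that] P Q PQ(2)] by simp
      also have "\<dots> = mat_trace m (?A g) + mat_trace (n - m) (?D g)"
        unfolding mat_trace_def using m by (subst sum_lessThan_shift[of m n]) auto
      finally show ?thesis .
    qed
    then have "?tr n \<rho> = ?tr m ?A + ?tr (n - m) ?D"
      by (simp add: sum.distrib distrib_left)
    then have "?tr m ?A \<noteq> 0 \<or> ?tr (n - m) ?D \<noteq> 0" using less.prems(2) by auto
    then show ?thesis using less.IH[OF _ reps(1)] less.IH[OF _ reps(2)] m by auto
  qed
qed

text \<open>Left translation by \<open>g\<close> fixes no group element unless \<open>g\<close> is
  the identity, so in the regular representation the weighted trace is \<open>y\<close> at the
  identity times the group order.\<close>

lemma exists_irred_rep_coefficient_detected: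
  assumes "group G" "finite (carrier G)" and "y \<one>\<^bsub>G\<^esub> \<noteq> 0"
  shows "\<exists>m \<sigma>. is_irred_rep G m \<sigma> \<and> (\<Sum>g\<in>carrier G. y g * mat_trace m (\<sigma> g)) \<noteq> 0"
proof -
  interpret group G by fact
  define N where "N = card (carrier G)"
  obtain e where e: "bij_betw e {..<N} (carrier G)"
    using ex_bij_betw_nat_finite[OF assms(2)] by (auto simp: N_def lessThan_atLeast0)
  have eG: "e i \<in> carrier G" if "i < N" for i using e that by (auto simp: bij_betw_def)
  have einj: "e i = e j \<longleftrightarrow> i = j" if "i < N" "j < N" for i j
    using e that by (auto simp: bij_betw_def inj_on_def)
  \<comment> \<open>the left regular representation, whose character is supported at the identity\<close>
  define \<rho> where "\<rho> g = mat N N (\<lambda>(i, j). if e i = g \<otimes>\<^bsub>G\<^esub> e j then 1 else 0 :: complex)" for g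
  have "\<rho> (g \<otimes>\<^bsub>G\<^esub> h) = \<rho> g * \<rho> h" if gh: "g \<in> carrier G" "h \<in> carrier G" for g h
  proof (rule eq_matI)
    fix i j assume "i < dim_row (\<rho> g * \<rho> h)" "j < dim_col (\<rho> g * \<rho> h)"
    then have ij: "i < N" "j < N" by (auto simp: \<rho>_def)
    have "h \<otimes>\<^bsub>G\<^esub> e j \<in> e ` {..<N}" using gh eG[OF ij(2)] e by (auto simp: bij_betw_def)
    then obtain l where l: "l < N" "e l = h \<otimes>\<^bsub>G\<^esub> e j" by auto
    have "(\<rho> g * \<rho> h) $$ (i, j) = (\<Sum>k<N. \<rho> g $$ (i, k) * \<rho> h $$ (k, j))"
      using ij by (intro mat_mult_index_sum) (auto simp: \<rho>_def)
    also have "\<dots> = (\<Sum>k<N. if k = l then \<rho> g $$ (i, l) else 0)"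
      using ij l einj by (intro sum.cong) (auto simp: \<rho>_def simp flip: l(2))
    also have "\<dots> = \<rho> g $$ (i, l)" using l by simp
    also have "\<dots> = \<rho> (g \<otimes>\<^bsub>G\<^esub> h) $$ (i, j)"
      using l ij gh eG by (simp add: \<rho>_def m_assoc)
    finally show "\<rho> (g \<otimes>\<^bsub>G\<^esub> h) $$ (i, j) = (\<rho> g * \<rho> h) $$ (i, j)" ..
  qed (auto simp: \<rho>_def)
  moreover have "\<rho> \<one>\<^bsub>G\<^esub> = 1\<^sub>m N"
    using einj eG by (intro eq_matI) (auto simp: \<rho>_def)
  ultimately have rep: "is_rep G N \<rho>" by (auto simp: is_rep_def \<rho>_def)
  have tr: "mat_trace N (\<rho> g) = (if g = \<one>\<^bsub>G\<^esub> then of_nat N else 0)" if "g \<in> carrier G" for g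
  proof -
    have "mat_trace N (\<rho> g) = (\<Sum>i<N. if g = \<one>\<^bsub>G\<^esub> then 1 else 0)"
      unfolding mat_trace_def using eG that by (intro sum.cong) (auto simp: \<rho>_def)
    then show ?thesis by simp
  qed
  have "(\<Sum>g\<in>carrier G. y g * mat_trace N (\<rho> g)) =
      (\<Sum>g\<in>carrier G. if g = \<one>\<^bsub>G\<^esub> then y \<one>\<^bsub>G\<^esub> * of_nat N else 0)"
    using tr by (intro sum.cong) auto
  also have "\<dots> = y \<one>\<^bsub>G\<^esub> * of_nat N" using assms(2) by simp
  also have "\<dots> \<noteq> 0" using assms(2,3) by (auto simp: N_def)
  finally show ?thesis by (intro exists_irred_rep_trace_sum_nonzero[OF _ rep]) (auto intro: is_monoid)
qed

subsection \<open>Convolution products of weights\<close>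

text \<open>Multiplication in the group algebra. Coefficients are real so that signs can be compared
  when nonvanishing is proved; \<open>rep_sum\<close>, the linear extension of a representation,
  embeds them into the complex numbers.\<close>

definition conv :: "('g, 'b) monoid_scheme \<Rightarrow> ('g \<Rightarrow> real) \<Rightarrow> ('g \<Rightarrow> real) \<Rightarrow> 'g \<Rightarrow> real" where
  "conv G a b g = (\<Sum>h\<in>carrier G. a h * b (inv\<^bsub>G\<^esub> h \<otimes>\<^bsub>G\<^esub> g))"

definition rep_sum :: "('g, 'b) monoid_scheme \<Rightarrow> nat \<Rightarrow> ('g \<Rightarrow> complex mat) \<Rightarrow> ('g \<Rightarrow> real) \<Rightarrow> complex mat" where
  "rep_sum G n \<rho> a = mat n n (\<lambda>(i, j). \<Sum>g\<in>carrier G. complex_of_real (a g) * \<rho> g $$ (i, j))"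

lemma rep_sum_carrier [simp]: "rep_sum G n \<rho> a \<in> carrier_mat n n"
  by (simp add: rep_sum_def)

lemma is_rep_mult_index:
  assumes "is_rep G n \<rho>" "g \<in> carrier G" "h \<in> carrier G" "i < n" "j < n"
  shows "\<rho> (g \<otimes>\<^bsub>G\<^esub> h) $$ (i, j) = (\<Sum>l<n. \<rho> g $$ (i, l) * \<rho> h $$ (l, j))"
  using assms mat_mult_index_sum[of "\<rho> g" n n "\<rho> h" n i j] by (simp add: is_rep_def)

lemma rep_sum_conv:
  assumes "group G" and rep: "is_rep G n \<rho>"
  shows "rep_sum G n \<rho> (conv G a b) = rep_sum G n \<rho> a * rep_sum G n \<rho> b"
proof (rule eq_matI)
  interpret group G by fact
  fix i j assume "i < dim_row (rep_sum G n \<rho> a * rep_sum G n \<rho> b)"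
    and "j < dim_col (rep_sum G n \<rho> a * rep_sum G n \<rho> b)"
  then have ij: "i < n" "j < n" by (auto simp: rep_sum_def)
  let ?a = "\<lambda>g. complex_of_real (a g)" and ?b = "\<lambda>g. complex_of_real (b g)"
  have "(rep_sum G n \<rho> a * rep_sum G n \<rho> b) $$ (i, j) =
      (\<Sum>l<n. \<Sum>g\<in>carrier G. \<Sum>h\<in>carrier G. ?a g * \<rho> g $$ (i, l) * (?b h * \<rho> h $$ (l, j)))"
    using ij by (subst mat_mult_index_sum[of _ n n _ n]) (auto simp: rep_sum_def sum_product)
  also have "\<dots> = (\<Sum>g\<in>carrier G. \<Sum>h\<in>carrier G. \<Sum>l<n. ?a g * \<rho> g $$ (i, l) * (?b h * \<rho> h $$ (l, j)))"
    by (subst sum.swap, rule sum.cong[OF refl], rule sum.swap)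
  also have "\<dots> = (\<Sum>g\<in>carrier G. \<Sum>h\<in>carrier G. ?a g * ?b h * \<rho> (g \<otimes>\<^bsub>G\<^esub> h) $$ (i, j))"
    using ij by (intro sum.cong refl)
      (simp add: is_rep_mult_index[OF rep] sum_distrib_left mult.assoc mult.left_commute)
  \<comment> \<open>For fixed \<open>g\<close>, substitute \<open>k\<close> for the product of
    \<open>g\<close> and \<open>h\<close>.\<close>
  also have "\<dots> = (\<Sum>g\<in>carrier G. \<Sum>k\<in>carrier G. ?a g * ?b (inv\<^bsub>G\<^esub> g \<otimes>\<^bsub>G\<^esub> k) * \<rho> k $$ (i, j))"
    by (intro sum.cong refl sum.reindex_bij_witness[of _ "\<lambda>k. inv\<^bsub>G\<^esub> _ \<otimes>\<^bsub>G\<^esub> k" "\<lambda>h. _ \<otimes>\<^bsub>G\<^esub> h"])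
      (auto simp: m_assoc[symmetric])
  also have "\<dots> = rep_sum G n \<rho> (conv G a b) $$ (i, j)"
    using ij by (subst sum.swap) (simp add: rep_sum_def conv_def sum_distrib_right)
  finally show "rep_sum G n \<rho> (conv G a b) $$ (i, j) = (rep_sum G n \<rho> a * rep_sum G n \<rho> b) $$ (i, j)" ..
qed (auto simp: rep_sum_def)

text \<open>In the group algebra this is \<open>|H| |K| (e\<^sub>H - e\<^sub>K)\<close> for the averaging idempotents.\<close>

definition atom_weight :: "'g set \<Rightarrow> 'g set \<Rightarrow> 'g \<Rightarrow> real" where
  "atom_weight H K g = (if g \<in> H then real (card K) else 0) - (if g \<in> K then real (card H) else 0)"

text \<open>Up to a positive scalar this is the product \<open>x\<close> of the opening overview,
  with factors in list order; the base case is the unit of the group algebra.\<close>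

primrec weight_product :: "('g, 'b) monoid_scheme \<Rightarrow> 'g set \<Rightarrow> 'g set list \<Rightarrow> 'g \<Rightarrow> real" where
  "weight_product G H [] = (\<lambda>g. if g = \<one>\<^bsub>G\<^esub> then 1 else 0)"
| "weight_product G H (K # Ks) = conv G (atom_weight H K) (weight_product G H Ks)"

section \<open>Annihilation and nonvanishing of the weight product\<close>

lemma (in group) sum_subgroup_left_translate:
  assumes "subgroup K G" "k \<in> K"
  shows "(\<Sum>h\<in>K. f (k \<otimes> h)) = (\<Sum>h\<in>K. f h)"
  using assms subgroup.mem_carrier[OF assms(1)]
  by (intro sum.reindex_bij_witness[of _ "\<lambda>h. inv k \<otimes> h" "\<lambda>h. k \<otimes> h"])
    (auto simp: m_assoc[symmetric] subgroup.m_closed subgroup.m_inv_closed)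

lemma (in group) sum_subgroup_right_translate:
  assumes "subgroup K G" "k \<in> K"
  shows "(\<Sum>h\<in>K. f (h \<otimes> k)) = (\<Sum>h\<in>K. f h)"
  using assms subgroup.mem_carrier[OF assms(1)]
  by (intro sum.reindex_bij_witness[of _ "\<lambda>h. h \<otimes> inv k" "\<lambda>h. h \<otimes> k"])
    (auto simp: m_assoc subgroup.m_closed subgroup.m_inv_closed)

text \<open>The columns of the sum of \<open>\<rho>\<close> over \<open>H\<close> are
  \<open>H\<close>-fixed, hence \<open>K\<close>-fixed. Summing \<open>\<rho>\<close> over all
  products of an element of \<open>K\<close> with one of \<open>H\<close> thus gives
  \<open>card K\<close> times the sum over \<open>H\<close>; by translation invariance it also gives
  \<open>card H\<close> times the sum over \<open>K\<close>.\<close>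

lemma rep_sum_atom_weight_eq_zero:
  assumes "group G" "finite (carrier G)" and H: "subgroup H G" and K: "subgroup K G" and "H \<subseteq> K"
    and rep: "is_rep G n \<rho>" and fixed_HK: "fixed_space n \<rho> H \<subseteq> fixed_space n \<rho> K"
  shows "rep_sum G n \<rho> (atom_weight H K) = 0\<^sub>m n n"
proof (rule eq_matI)
  interpret group G by fact
  have HG: "H \<subseteq> carrier G" and KG: "K \<subseteq> carrier G" using H K subgroup.subset by auto
  fix i j assume "i < dim_row (0\<^sub>m n n :: complex mat)" "j < dim_col (0\<^sub>m n n :: complex mat)"
  then have ij: "i < n" "j < n" by auto
  \<comment> \<open>Column \<open>j\<close> of the sum of \<open>\<rho>\<close> over
    \<open>H\<close>.\<close>
  define v where "v = vec n (\<lambda>i. \<Sum>h\<in>H. \<rho> h $$ (i, j))"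
  have act: "(\<rho> k *\<^sub>v v) $ l = (\<Sum>h\<in>H. \<rho> (k \<otimes>\<^bsub>G\<^esub> h) $$ (l, j))" if "k \<in> carrier G" "l < n" for k l
  proof -
    have "\<rho> k \<in> carrier_mat n n" using rep that by (auto simp: is_rep_def)
    then have "(\<rho> k *\<^sub>v v) $ l = (\<Sum>m<n. \<rho> k $$ (l, m) * (\<Sum>h\<in>H. \<rho> h $$ (m, j)))"
      using that by (auto simp: v_def scalar_prod_def lessThan_atLeast0 intro!: sum.cong)
    also have "\<dots> = (\<Sum>h\<in>H. \<Sum>m<n. \<rho> k $$ (l, m) * \<rho> h $$ (m, j))"
      by (simp add: sum_distrib_left) (rule sum.swap)
    also have "\<dots> = (\<Sum>h\<in>H. \<rho> (k \<otimes>\<^bsub>G\<^esub> h) $$ (l, j))"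
      using is_rep_mult_index[OF rep that(1) _ that(2) ij(2)] HG by (intro sum.cong) auto
    finally show ?thesis .
  qed
  have "v \<in> fixed_space n \<rho> H"
  proof -
    have "\<rho> k *\<^sub>v v = v" if k: "k \<in> H" for k
    proof (rule eq_vecI)
      fix l assume "l < dim_vec v"
      then have l: "l < n" by (simp add: v_def)
      show "(\<rho> k *\<^sub>v v) $ l = v $ l"
        using act[of k l] sum_subgroup_left_translate[OF H k, of "\<lambda>h. \<rho> h $$ (l, j)"] k HG l
        by (auto simp: v_def)
    qed (use k HG rep in \<open>auto simp: is_rep_def v_def\<close>)
    then show ?thesis by (simp add: fixed_space_def v_def)
  qed
  then have "v \<in> fixed_space n \<rho> K" using fixed_HK by auto
  then have inner: "(\<Sum>h\<in>H. \<rho> (k \<otimes>\<^bsub>G\<^esub> h) $$ (i, j)) = (\<Sum>h\<in>H. \<rho> h $$ (i, j))" if "k \<in> K" for k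
    using act[of k i] that KG ij by (auto simp: fixed_space_def v_def)
  have "of_nat (card K) * (\<Sum>h\<in>H. \<rho> h $$ (i, j)) = (\<Sum>k\<in>K. \<Sum>h\<in>H. \<rho> (k \<otimes>\<^bsub>G\<^esub> h) $$ (i, j))"
    using inner by simp
  also have "\<dots> = (\<Sum>h\<in>H. \<Sum>k\<in>K. \<rho> (k \<otimes>\<^bsub>G\<^esub> h) $$ (i, j))" by (rule sum.swap)
  also have "\<dots> = of_nat (card H) * (\<Sum>k\<in>K. \<rho> k $$ (i, j))"
    using \<open>H \<subseteq> K\<close> by (simp add: sum_subgroup_right_translate[OF K, where f = "\<lambda>x. \<rho> x $$ (i, j)"] subset_iff)
  finally have eq: "of_nat (card K) * (\<Sum>h\<in>H. \<rho> h $$ (i, j)) = of_nat (card H) * (\<Sum>k\<in>K. \<rho> k $$ (i, j))" .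
  have restrict: "(\<Sum>g\<in>carrier G. complex_of_real (if g \<in> S then c else 0) * \<rho> g $$ (i, j)) =
      complex_of_real c * (\<Sum>g\<in>S. \<rho> g $$ (i, j))" if "S \<subseteq> carrier G" for S c
    unfolding sum_distrib_left
    by (rule sum.mono_neutral_cong_right) (use that assms(2) in auto)
  show "rep_sum G n \<rho> (atom_weight H K) $$ (i, j) = 0\<^sub>m n n $$ (i, j)"
    using ij eq by (simp add: rep_sum_def atom_weight_def left_diff_distrib sum_subtractf
        restrict[OF HG] restrict[OF KG] del: if_distrib)
qed (auto simp: rep_sum_def)

text \<open>Since \<open>rep_sum\<close> is multiplicative, one vanishing factor annihilates the
  product. Read contrapositively, a nonzero action yields for each listed \<open>K\<close> an
  \<open>H\<close>-fixed vector that \<open>K\<close> moves.\<close>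

lemma rep_sum_weight_product_eq_zero:
  assumes "group G" "finite (carrier G)" "subgroup H G" "is_rep G n \<rho>"
    and "K \<in> set Ks" "subgroup K G" "H \<subseteq> K" "fixed_space n \<rho> H \<subseteq> fixed_space n \<rho> K"
  shows "rep_sum G n \<rho> (weight_product G H Ks) = 0\<^sub>m n n"
  using \<open>K \<in> set Ks\<close>
proof (induction Ks)
  case (Cons L Ks)
  show ?case
  proof (cases "K = L")
    case True
    then show ?thesis
      using rep_sum_atom_weight_eq_zero[OF assms(1-3,6-7,4,8)]
      by (simp add: rep_sum_conv[OF assms(1,4)] left_mult_zero_mat[OF rep_sum_carrier])
  next
    case False
    then show ?thesis
      using Cons by (simp add: rep_sum_conv[OF assms(1,4)] right_mult_zero_mat[OF rep_sum_carrier])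
  qed
qed simp

text \<open>Each factor is supported in the union of \<open>H\<close> and its \<open>K\<close>, and
  \<open>L\<close> is closed under products. With \<open>L\<close> taken as \<open>M K\<close>, this
  will discard the terms in which the factor of \<open>K\<close> contributes an element of
  \<open>H\<close>.\<close>

lemma weight_product_support:
  assumes "group G" "subgroup L G" "H \<subseteq> L" "\<Union>(set Ks) \<subseteq> L"
    and "g \<in> carrier G" "weight_product G H Ks g \<noteq> 0"
  shows "g \<in> L"
  using assms(4-6)
proof (induction Ks arbitrary: g)
  case Nil
  then show ?case using assms(2) by (auto simp: subgroup.one_closed split: if_splits)
next
  case (Cons K Ks)
  interpret group G by fact
  obtain h where h: "h \<in> carrier G" "atom_weight H K h \<noteq> 0"
      "weight_product G H Ks (inv\<^bsub>G\<^esub> h \<otimes>\<^bsub>G\<^esub> g) \<noteq> 0"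
    using Cons.prems(3) by (auto simp: conv_def elim!: sum.not_neutral_contains_not_neutral)
  have "h \<in> L" using h(2) assms(3) Cons.prems(1) by (auto simp: atom_weight_def split: if_splits)
  moreover have "inv\<^bsub>G\<^esub> h \<otimes>\<^bsub>G\<^esub> g \<in> L" using Cons h by auto
  ultimately have "h \<otimes>\<^bsub>G\<^esub> (inv\<^bsub>G\<^esub> h \<otimes>\<^bsub>G\<^esub> g) \<in> L" by (rule subgroup.m_closed[OF assms(2)])
  then show ?case using h Cons.prems(2) by (simp add: m_assoc[symmetric])
qed

lemma (in group) subgroup_mult_left_cancel:
  assumes "subgroup L G" "h \<in> L" "g \<in> carrier G" "h \<otimes> g \<in> L"
  shows "g \<in> L"
proof -
  have "inv h \<otimes> (h \<otimes> g) \<in> L"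
    by (rule subgroup.m_closed[OF assms(1) subgroup.m_inv_closed[OF assms(1,2)] assms(4)])
  moreover have "inv h \<otimes> (h \<otimes> g) = g"
    using assms(3) subgroup.mem_carrier[OF assms(1,2)] by (simp add: m_assoc[symmetric])
  ultimately show ?thesis by simp
qed

text \<open>The witness is a product of one element from each \<open>K - H\<close>. The family
  \<open>M\<close> is fixed in advance instead of being built from the list, so its hypotheses pass
  to the tail in the induction.\<close>

lemma weight_product_nonzero:
  assumes "group G" "finite (carrier G)" and H: "subgroup H G" and "distinct Ks"
    and K: "\<And>K. K \<in> set Ks \<Longrightarrow> subgroup K G \<and> H \<subset> K"
    and M: "\<And>K. K \<in> set Ks \<Longrightarrow> subgroup (M K) G \<and> K \<inter> M K = H"
    and KM: "\<And>K L. K \<in> set Ks \<Longrightarrow> L \<in> set Ks \<Longrightarrow> L \<noteq> K \<Longrightarrow> L \<subseteq> M K"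
  shows "\<exists>g\<in>carrier G. weight_product G H Ks g \<noteq> 0"
proof -
  interpret group G by fact
  \<comment> \<open>Off all \<open>M K\<close> only the all-\<open>K\<close> term of the expanded product contributes, with sign \<open>(-1)\<^sup>r\<close>.\<close>
  let ?good = "\<lambda>Ks g. g \<in> carrier G \<and> (\<forall>K\<in>set Ks. g \<notin> M K)"
  let ?x = "\<lambda>Ks g. (-1) ^ length Ks * weight_product G H Ks g"
  \<comment> \<open>Nonnegativity at all good points excludes cancellation. Recording that the
    witness lies in every subgroup containing the list members places it in \<open>M K\<close> once
    a new \<open>K\<close> is prepended.\<close>
  have "(\<forall>g. ?good Ks g \<longrightarrow> ?x Ks g \<ge> 0) \<and>
      (\<exists>g. ?good Ks g \<and> (\<forall>L. subgroup L G \<longrightarrow> \<Union>(set Ks) \<subseteq> L \<longrightarrow> g \<in> L) \<and> ?x Ks g > 0)"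
    using assms(4-)
  proof (induction Ks)
    case Nil
    then show ?case by (auto intro!: exI[of _ "\<one>\<^bsub>G\<^esub>"] subgroup.one_closed)
  next
    case (Cons K Ks)
    have IH: "\<And>g. ?good Ks g \<Longrightarrow> ?x Ks g \<ge> 0"
      "\<exists>g. ?good Ks g \<and> (\<forall>L. subgroup L G \<longrightarrow> \<Union>(set Ks) \<subseteq> L \<longrightarrow> g \<in> L) \<and> ?x Ks g > 0"
      using Cons.IH Cons.prems by simp_all
    have K: "subgroup K G" "H \<subset> K" "K \<subseteq> carrier G"
      using Cons.prems(2)[of K] subgroup.subset by auto
    have joinK: "subgroup (M K) G" "K \<inter> M K = H" "H \<subseteq> M K" "\<Union>(set Ks) \<subseteq> M K"
      using Cons.prems(1) Cons.prems(3)[of K] Cons.prems(4)[of K] by auto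
    have joinL: "subgroup (M L) G" "K \<subseteq> M L" if "L \<in> set Ks" for L
      using that Cons.prems(1) Cons.prems(3)[of L] Cons.prems(4)[of L K] by auto
    have Hpos: "card H > 0"
      using H assms(2) finite_subset[OF subgroup.subset[OF H]] subgroup.one_closed[OF H]
      by (auto simp: card_gt_0_iff)
    have x_Cons: "?x (K # Ks) g =
        (\<Sum>h\<in>carrier G. - atom_weight H K h * ?x Ks (inv\<^bsub>G\<^esub> h \<otimes>\<^bsub>G\<^esub> g))" for g
      by (simp add: conv_def sum_distrib_left sum_negf mult.left_commute)
    have wt: "- atom_weight H K h = real (card H)" if "h \<in> K" "h \<notin> H" for h
      using that by (simp add: atom_weight_def)
    have nonneg_at: "- atom_weight H K h * ?x Ks (inv\<^bsub>G\<^esub> h \<otimes>\<^bsub>G\<^esub> g) \<ge> 0"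
      if g: "?good (K # Ks) g" and h: "h \<in> carrier G" for g h
    proof -
      \<comment> \<open>For \<open>h\<close> in \<open>H\<close> the remaining argument stays
        outside \<open>M K\<close>, where the tail product vanishes. For \<open>h\<close> in
        \<open>K - H\<close> the signed weight is positive, and the argument stays outside each
        \<open>M L\<close> because \<open>K\<close> lies in \<open>M L\<close>.\<close>
      consider "h \<in> H" | "h \<in> K" "h \<notin> H" | "h \<notin> K" by blast
      then show ?thesis
      proof cases
        case 1
        have "inv\<^bsub>G\<^esub> h \<otimes>\<^bsub>G\<^esub> g \<notin> M K"
          using 1 g h subgroup_mult_left_cancel[OF joinK(1), of "inv\<^bsub>G\<^esub> h" g]
            subgroup.m_inv_closed[OF joinK(1)] joinK(3) by auto
        then have "weight_product G H Ks (inv\<^bsub>G\<^esub> h \<otimes>\<^bsub>G\<^esub> g) = 0"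
          using weight_product_support[OF assms(1) joinK(1,3,4), of "inv\<^bsub>G\<^esub> h \<otimes>\<^bsub>G\<^esub> g"] g h by auto
        then show ?thesis by simp
      next
        case 2
        have "inv\<^bsub>G\<^esub> h \<otimes>\<^bsub>G\<^esub> g \<notin> M L" if "L \<in> set Ks" for L
          using 2 g h that subgroup_mult_left_cancel[OF joinL(1)[OF that], of "inv\<^bsub>G\<^esub> h" g]
            subgroup.m_inv_closed[OF joinL(1)[OF that]] joinL(2)[OF that] by auto
        then have "?x Ks (inv\<^bsub>G\<^esub> h \<otimes>\<^bsub>G\<^esub> g) \<ge> 0" using g h by (intro IH(1)) auto
        then show ?thesis unfolding wt[OF 2] by simp
      next
        case 3
        then have "atom_weight H K h = 0" using K(2) by (auto simp: atom_weight_def)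
        then show ?thesis by simp
      qed
    qed
    obtain g' where g': "?good Ks g'" "?x Ks g' > 0"
        "\<And>L. subgroup L G \<Longrightarrow> \<Union>(set Ks) \<subseteq> L \<Longrightarrow> g' \<in> L"
      using IH(2) by blast
    obtain k where k: "k \<in> K" "k \<notin> H" using K(2) by blast
    have kG: "k \<in> carrier G" using k K by auto
    let ?g = "k \<otimes>\<^bsub>G\<^esub> g'"
    \<comment> \<open>Otherwise cancelling \<open>g'\<close>, which lies in \<open>M K\<close>,
      would put \<open>k\<close> into the intersection of \<open>K\<close> and \<open>M K\<close>,
      which is \<open>H\<close>.\<close>
    have "?g \<notin> M K"
    proof
      assume a: "?g \<in> M K"
      have "g' \<in> M K" using g'(3) joinK by blast
      then have "?g \<otimes>\<^bsub>G\<^esub> inv\<^bsub>G\<^esub> g' \<in> M K"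
        using subgroup.m_closed[OF joinK(1) a subgroup.m_inv_closed[OF joinK(1)]] by blast
      then show False using k kG g'(1) joinK(2) by (auto simp: m_assoc)
    qed
    moreover have "?g \<notin> M L" if "L \<in> set Ks" for L
      using subgroup_mult_left_cancel[OF joinL(1)[OF that], of k g'] joinL(2)[OF that] k g'(1) that by auto
    ultimately have good: "?good (K # Ks) ?g" using kG g'(1) by auto
    have "?x (K # Ks) ?g > 0"
      unfolding x_Cons
    proof (rule sum_pos2[OF assms(2) kG])
      have "inv\<^bsub>G\<^esub> k \<otimes>\<^bsub>G\<^esub> ?g = g'" using kG g'(1) by (simp add: m_assoc[symmetric])
      then show "- atom_weight H K k * ?x Ks (inv\<^bsub>G\<^esub> k \<otimes>\<^bsub>G\<^esub> ?g) > 0"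
        using g'(2) Hpos by (simp only: wt[OF k]) simp
    qed (rule nonneg_at[OF good])
    moreover have "?g \<in> L" if "subgroup L G" "\<Union>(set (K # Ks)) \<subseteq> L" for L
      using that k g'(3)[of L] by (auto intro: subgroup.m_closed)
    moreover have "?x (K # Ks) g \<ge> 0" if "?good (K # Ks) g" for g
      unfolding x_Cons by (intro sum_nonneg nonneg_at[OF that])
    ultimately show ?case using good by blast
  qed
  then obtain g where "g \<in> carrier G" "?x Ks g > 0" by blast
  then show ?thesis by (intro bexI[of _ g]) auto
qed

text \<open>Right translation by \<open>g0\<close> moves the nonzero coefficient to the identity.
  The resulting weighted trace is the trace of \<open>rep_sum G n \<rho> x\<close> times the matrix
  of the inverse of \<open>g0\<close>, so \<open>rep_sum\<close> cannot vanish.\<close>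

lemma exists_irred_rep_rep_sum_nonzero:
  assumes "group G" "finite (carrier G)" and g0: "g0 \<in> carrier G" "x g0 \<noteq> 0"
  shows "\<exists>n \<rho>. is_irred_rep G n \<rho> \<and> rep_sum G n \<rho> x \<noteq> 0\<^sub>m n n"
proof -
  interpret group G by fact
  let ?y = "\<lambda>g. complex_of_real (x (g \<otimes>\<^bsub>G\<^esub> g0))"
  have "?y \<one>\<^bsub>G\<^esub> \<noteq> 0" using g0 by simp
  then obtain n \<rho> where irr: "is_irred_rep G n \<rho>"
    and nz: "(\<Sum>g\<in>carrier G. ?y g * mat_trace n (\<rho> g)) \<noteq> 0"
    using exists_irred_rep_coefficient_detected[OF assms(1,2), of ?y] by blast
  have rep: "is_rep G n \<rho>" using irr by (simp add: is_irred_rep_def)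
  have "(\<Sum>g\<in>carrier G. ?y g * mat_trace n (\<rho> g)) =
      (\<Sum>g\<in>carrier G. complex_of_real (x g) * mat_trace n (\<rho> (g \<otimes>\<^bsub>G\<^esub> inv\<^bsub>G\<^esub> g0)))"
    using g0 by (intro sum.reindex_bij_witness[of _ "\<lambda>g. g \<otimes>\<^bsub>G\<^esub> inv\<^bsub>G\<^esub> g0" "\<lambda>g. g \<otimes>\<^bsub>G\<^esub> g0"])
      (auto simp: m_assoc)
  also have "\<dots> = (\<Sum>g\<in>carrier G. \<Sum>i<n. \<Sum>l<n.
      complex_of_real (x g) * \<rho> g $$ (i, l) * \<rho> (inv\<^bsub>G\<^esub> g0) $$ (l, i))"
    using g0 by (intro sum.cong refl)
      (simp add: mat_trace_def is_rep_mult_index[OF rep] sum_distrib_left mult.assoc)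
  also have "\<dots> = (\<Sum>i<n. \<Sum>l<n. \<Sum>g\<in>carrier G.
      complex_of_real (x g) * \<rho> g $$ (i, l) * \<rho> (inv\<^bsub>G\<^esub> g0) $$ (l, i))"
    by (subst sum.swap, rule sum.cong[OF refl], rule sum.swap)
  also have "\<dots> = (\<Sum>i<n. \<Sum>l<n. rep_sum G n \<rho> x $$ (i, l) * \<rho> (inv\<^bsub>G\<^esub> g0) $$ (l, i))"
    by (intro sum.cong refl) (simp add: rep_sum_def sum_distrib_right)
  finally have "rep_sum G n \<rho> x \<noteq> 0\<^sub>m n n" using nz by auto
  then show ?thesis using irr by blast
qed

subsection \<open>Atoms of the interval\<close>

definition interval_atoms :: "('g, 'b) monoid_scheme \<Rightarrow> 'g set \<Rightarrow> 'g set set" where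
  "interval_atoms G H = {K. subgroup K G \<and> H \<subset> K \<and> (\<forall>L. subgroup L G \<longrightarrow> H \<subset> L \<longrightarrow> L \<subseteq> K \<longrightarrow> L = K)}"

lemma interval_atom_below:
  assumes "finite (carrier G)" "subgroup S G" "H \<subset> S"
  shows "\<exists>K\<in>interval_atoms G H. K \<subseteq> S"
  using assms(2,3)
proof (induction "card S" arbitrary: S rule: less_induct)
  case less
  show ?case
  proof (cases "S \<in> interval_atoms G H")
    case False
    then obtain L where L: "subgroup L G" "H \<subset> L" "L \<subset> S"
      using less.prems by (auto simp: interval_atoms_def)
    moreover have "finite S" using finite_subset[OF subgroup.subset[OF less.prems(1)] assms(1)] .
    ultimately show ?thesis using less.hyps[of L] psubset_card_mono[of S L] by blast
  qed auto
qed

text \<open>Distributivity enters here: adding an atom \<open>L\<close> to a join \<open>J\<close>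
  of atoms turns the meet with \<open>K\<close> into the join of \<open>K \<inter> L\<close> and
  \<open>K \<inter> J\<close>, both equal to \<open>H\<close>. Including \<open>H\<close> among the
  generators makes the empty join equal to \<open>H\<close>.\<close>

lemma interval_atom_meet_join:
  assumes "group G" and H: "subgroup H G" and distr: "interval_distributive G H"
    and K: "K \<in> interval_atoms G H" and "finite F" "F \<subseteq> interval_atoms G H" "K \<notin> F"
  shows "K \<inter> generate G (H \<union> \<Union>F) = H"
  using assms(5-)
proof (induction F)
  case empty
  interpret group G by fact
  have "generate G H \<subseteq> H" by (rule generate_subgroup_incl[OF _ H]) simp
  then show ?case using K by (auto simp: interval_atoms_def intro: generate.incl)
next
  case (insert L F)
  interpret group G by fact
  let ?J = "generate G (H \<union> \<Union>F)"
  have HG: "H \<subseteq> carrier G" using subgroup.subset[OF H] .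
  have sub: "M \<in> interval_atoms G H \<Longrightarrow> subgroup M G \<and> M \<subseteq> carrier G \<and> H \<subset> M" for M
    using subgroup.subset by (auto simp: interval_atoms_def)
  have car: "H \<union> \<Union>F \<subseteq> carrier G" using insert.prems(1) sub HG by blast
  then have J: "subgroup ?J G" by (rule generate_is_subgroup)
  have HJ: "H \<union> \<Union>F \<subseteq> ?J" by (auto intro: generate.incl)
  have LG: "L \<in> interval_atoms G H" using insert.prems by auto
  \<comment> \<open>If the intersection exceeded \<open>H\<close>, minimality of both atoms would
    identify it with each of them.\<close>
  have meet: "K \<inter> L = H"
  proof (rule ccontr)
    assume ne: "K \<inter> L \<noteq> H"
    have "H \<subset> K \<inter> L" using sub[OF K] sub[OF LG] ne by auto
    moreover have "subgroup (K \<inter> L) G" using sub[OF K] sub[OF LG] by (auto intro: subgroups_Inter_pair)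
    ultimately have "K \<inter> L = K" "K \<inter> L = L" using K LG unfolding interval_atoms_def by blast+
    then show False using insert.prems by auto
  qed
  have in_int: "K \<in> subgroup_interval G H" "L \<in> subgroup_interval G H" "?J \<in> subgroup_interval G H"
    using sub[OF K] sub[OF LG] J HJ by (auto simp: subgroup_interval_def)
  have "generate G (H \<union> \<Union>(insert L F)) \<subseteq> generate G (L \<union> ?J)"
    using HJ by (intro mono_generate) auto
  then have "K \<inter> generate G (H \<union> \<Union>(insert L F)) \<subseteq> K \<inter> generate G (L \<union> ?J)" by auto
  also have "\<dots> = generate G ((K \<inter> L) \<union> (K \<inter> ?J))"
    using distr in_int unfolding interval_distributive_def by blast
  also have "\<dots> = generate G H" using meet insert by auto
  also have "\<dots> \<subseteq> H" by (rule generate_subgroup_incl[OF _ H]) simp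
  finally show ?case using sub[OF K] by (auto intro: generate.incl)
qed

section \<open>Pointwise stabilizers and the conclusion\<close>

lemma pointwise_stab_subgroup:
  assumes "group G" "is_rep G n \<rho>" "X \<subseteq> carrier_vec n"
  shows "subgroup (pointwise_stab G \<rho> X) G"
proof -
  interpret group G by fact
  have car: "\<rho> g \<in> carrier_mat n n" if "g \<in> carrier G" for g using assms(2) that by (simp add: is_rep_def)
  have mult: "\<rho> (g \<otimes>\<^bsub>G\<^esub> h) *\<^sub>v x = \<rho> g *\<^sub>v (\<rho> h *\<^sub>v x)"
    if "g \<in> carrier G" "h \<in> carrier G" "x \<in> X" for g h x
    using that assms car by (auto simp: is_rep_def intro!: assoc_mult_mat_vec[of _ n n _ n])
  have one: "\<rho> \<one>\<^bsub>G\<^esub> *\<^sub>v x = x" if "x \<in> X" for x using assms(2,3) that by (auto simp: is_rep_def)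
  show ?thesis
  proof (rule subgroupI)
    fix g assume g: "g \<in> pointwise_stab G \<rho> X"
    have "\<rho> (inv\<^bsub>G\<^esub> g) *\<^sub>v x = x" if x: "x \<in> X" for x
    proof -
      have "\<rho> (inv\<^bsub>G\<^esub> g) *\<^sub>v x = \<rho> (inv\<^bsub>G\<^esub> g) *\<^sub>v (\<rho> g *\<^sub>v x)" using g x by (simp add: pointwise_stab_def)
      also have "\<dots> = x" using mult[of "inv\<^bsub>G\<^esub> g" g x] g x one by (simp add: pointwise_stab_def)
      finally show ?thesis .
    qed
    then show "inv\<^bsub>G\<^esub> g \<in> pointwise_stab G \<rho> X" using g by (simp add: pointwise_stab_def)
  qed (auto simp: pointwise_stab_def mult one)
qed

theorem theorem1p2:
  fixes G :: "('g, 'b) monoid_scheme" and H :: "'g set"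
  assumes "group G" and "finite (carrier G)" and "subgroup H G"
    and "interval_distributive G H"
  shows "\<exists>n \<rho>. is_irred_rep G n \<rho> \<and> pointwise_stab G \<rho> (fixed_space n \<rho> H) = H"
proof -
  interpret group G by fact
  let ?A = "interval_atoms G H"
  have sub: "K \<in> ?A \<Longrightarrow> subgroup K G \<and> K \<subseteq> carrier G \<and> H \<subset> K" for K
    using subgroup.subset by (auto simp: interval_atoms_def)
  have HG: "H \<subseteq> carrier G" using subgroup.subset[OF assms(3)] .
  have "?A \<subseteq> Pow (carrier G)" using sub by blast
  then have fin: "finite ?A" using assms(2) finite_subset by auto
  then obtain Ks where Ks: "set Ks = ?A" "distinct Ks" using finite_distinct_list by blast
  \<comment> \<open>The join of all atoms other than \<open>K\<close>, with \<open>H\<close>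
    included in case there are no others.\<close>
  define M where "M K = generate G (H \<union> \<Union>(?A - {K}))" for K
  have M: "subgroup (M K) G" for K
    unfolding M_def by (rule generate_is_subgroup) (use sub HG in blast)
  have KM: "K \<inter> M K = H" if "K \<in> ?A" for K
    unfolding M_def using fin that by (intro interval_atom_meet_join[OF assms(1,3,4)]) auto
  have LM: "L \<subseteq> M K" if "L \<in> ?A" "L \<noteq> K" for K L
    unfolding M_def using that by (auto intro: generate.incl)
  obtain g where "g \<in> carrier G" "weight_product G H Ks g \<noteq> 0"
    using weight_product_nonzero[OF assms(1-3) Ks(2), of M] sub M KM LM Ks(1) by auto
  then obtain n \<rho> where irr: "is_irred_rep G n \<rho>"
    and nz: "rep_sum G n \<rho> (weight_product G H Ks) \<noteq> 0\<^sub>m n n"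
    using exists_irred_rep_rep_sum_nonzero[OF assms(1,2)] by blast
  have rep: "is_rep G n \<rho>" using irr by (simp add: is_irred_rep_def)
  let ?S = "pointwise_stab G \<rho> (fixed_space n \<rho> H)"
  have S: "subgroup ?S G"
    by (rule pointwise_stab_subgroup[OF assms(1) rep]) (auto simp: fixed_space_def)
  have HS: "H \<subseteq> ?S" using HG by (auto simp: pointwise_stab_def fixed_space_def)
  have "?S = H"
  proof (rule ccontr)
    assume "?S \<noteq> H"
    then obtain K where K: "K \<in> ?A" "K \<subseteq> ?S"
      using interval_atom_below[OF assms(2) S] HS by blast
    \<comment> \<open>An atom inside the stabilizer fixes every \<open>H\<close>-fixed vector, so
      its factor acts as zero, against the choice of \<open>\<rho>\<close>.\<close>
    have "fixed_space n \<rho> H \<subseteq> fixed_space n \<rho> K"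
      using K(2) by (auto simp: fixed_space_def pointwise_stab_def)
    then show False
      using nz rep_sum_weight_product_eq_zero[OF assms(1-3) rep, of K Ks] K(1) sub Ks(1) by auto
  qed
  then show ?thesis using irr by blast
qed

end
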